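(* In the semi-synchronous Eventual Transport (ET) model where only an upper bound $N$ on the ring size is known to the agents, for any number of agents there does not exist any algorithm solving exploration of 1-interval connected rings with partial termination. This holds true even if the ring has a landmark node, the agents have distinct IDs, and there is common chirality.
   Context: Ring: the nodes $v_0,\dots,v_{n-1}$ (indices modulo $n$) form a cycle; $v_i$ is linked to $v_{i-1}$ and $v_{i+1}$ via distinctly labelled ports $q_{i-}$ and $q_{i+}$ (labels need not be globally consistent). Time proceeds in rounds; in each round at most one edge, chosen by an adversary, is missing (1-interval connected ring). Landmark: one node is different from all others, and an agent performing Look at a node sees whether that node is the landmark. The agents know $N$ but not the exact size $n\le N$; the algorithm must be correct for every ring size compatible with $N$. Agents: each has memory and computational power; all execute the same deterministic protocol (with distinct IDs, behaviour may depend on the ID). They start at arbitrary, not necessarily distinct, nodes, cannot communicate explicitly and cannot mark nodes. Each agent $a_j$ has a consistent private orientation, i.e. a function $\lambda_j$ designating each port left or right with $\lambda_j(q_{i-})=\lambda_j(q_{k-})$ for all $i,k$. Chirality: all agents have the same orientation and are aware of it. Round: each active agent performs Look (it sees its own position within its node, i.e. whether it is on a port and which one, and the positions of the other agents at that node), Compute (from this snapshot and its memory it determines a direction in $\{left,right,nil\}$; if $nil$ it becomes inactive; otherwise it tries to access the corresponding port if not already there), and Move. Ports are accessed in mutual exclusion: an occupied port cannot be gained, and if several agents try the same port exactly one succeeds; an agent that fails sets $moved=false$ and becomes inactive. An agent on a port after computing moves to the other endpoint if the edge is present in this round (setting $moved=true$), and otherwise stays on the port (setting $moved=false$); in either case the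 port is denied to other agents in that round. Two agents crossing the same edge in opposite directions in the same round might not detect each other. Semi-synchronous ($\mathcal{SSYNC}$): in each round an adversary activates a non-empty subset of the agents, the others being asleep (passive); every agent is activated infinitely often; an activated agent does not know whether it was active in the previous round. An agent may be asleep on a port. ET model: a sleeping agent cannot move; if an agent is sleeping on a port at round $t$ and the corresponding edge is present infinitely many times, then the agent will eventually become active at a round $t'>t$ when the corresponding edge is present. Exploration is solved if within finite time every node is visited by at least one agent, in every execution (all initial positions and all adversary choices of activations and missing edges). It is with partial termination if at least one agent, within finite time, enters a terminal state and no longer moves; a terminal state may be entered only after the ring has been explored. *)

theory Defs
  imports "HOL-Library.Multiset"
begin

text \<open>
  Nodes are the numbers \<open>0, \<dots>, n - 1\<close>. Edge \<open>i\<close> joins node \<open>i\<close> and node \<open>(i + 1) mod n\<close>.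
  Port \<open>Plus\<close> of node \<open>i\<close> leads along edge \<open>i\<close>, port \<open>Minus\<close> along edge \<open>(i - 1) mod n\<close>.
  Agents do not see these global names; they only see ports as left or right.
\<close>

datatype side = Minus | Plus

datatype dir = Left | Right

fun port_edge :: "nat \<Rightarrow> nat \<Rightarrow> side \<Rightarrow> nat" where
  "port_edge n v Plus = v"
| "port_edge n v Minus = (v + n - 1) mod n"

fun neighbour :: "nat \<Rightarrow> nat \<Rightarrow> side \<Rightarrow> nat" where
  "neighbour n v Plus = (v + 1) mod n"
| "neighbour n v Minus = (v + n - 1) mod n"

text \<open>
  \<open>port = None\<close> means that the agent is in the node but on neither of its ports.
  \<open>moved\<close> is the outcome of the agent's last attempt to move.
\<close>

record 'm agent =
  node :: nat
  port :: "side option"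
  mem :: 'm
  moved :: bool

type_synonym 'm config = "nat \<Rightarrow> 'm agent"

text \<open>
  What Look returns: the agent's own position within its node, the identifiers and positions of the
  other agents at that node, and whether the node is the landmark. Positions are expressed in the
  agent's private orientation.
\<close>

datatype snapshot =
  Snapshot (own: "dir option") (others: "(nat \<times> dir option) multiset") (at_landmark: bool)

text \<open>
  A deterministic protocol over memory states of type \<open>'m\<close>, which may be infinite. The first
  argument of \<open>init\<close> and \<open>compute\<close> is the identifier of the executing agent, the third argument of
  \<open>compute\<close> is its \<open>moved\<close> variable. Direction nil is \<open>None\<close>.
\<close>

record 'm protocol =
  init :: "nat \<Rightarrow> 'm"
  compute :: "nat \<Rightarrow> 'm \<Rightarrow> bool \<Rightarrow> snapshot \<Rightarrow> 'm \<times> dir option"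
  terminal :: "'m \<Rightarrow> bool"

definition wf_protocol :: "'m protocol \<Rightarrow> bool" where
  "wf_protocol A \<longleftrightarrow>
     (\<forall>i m b s m' d. compute A i m b s = (m', d) \<longrightarrow>
        (terminal A m \<longrightarrow> terminal A m') \<and> (terminal A m' \<longrightarrow> d = None))"

text \<open>
  The agents are \<open>0, \<dots>, team - 1\<close>; these indices are not visible to them. What an agent \<open>j\<close> knows,
  and shows to others, is \<open>ident j\<close>: an injective \<open>ident\<close> gives distinct identifiers, a constant one
  gives anonymous agents. Orientations are consistent because \<open>orient j\<close> does not depend on the node.
\<close>

record world =
  ring_size :: nat
  landmark_at :: "nat option"
  team :: nat
  ident :: "nat \<Rightarrow> nat"
  orient :: "nat \<Rightarrow> side \<Rightarrow> dir"

definition admissible ::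
    "nat \<Rightarrow> nat \<Rightarrow> (nat \<Rightarrow> nat) \<Rightarrow> bool \<Rightarrow> bool \<Rightarrow> world \<Rightarrow> bool" where
  "admissible N k ids has_landmark chirality W \<longleftrightarrow>
     3 \<le> ring_size W \<and> ring_size W \<le> N \<and> team W = k \<and> ident W = ids \<and>
     (if has_landmark then \<exists>l < ring_size W. landmark_at W = Some l else landmark_at W = None) \<and>
     (\<forall>j < k. bij (orient W j)) \<and>
     (chirality \<longrightarrow> (\<forall>i < k. \<forall>j < k. orient W i = orient W j))"

definition look :: "world \<Rightarrow> 'm config \<Rightarrow> nat \<Rightarrow> snapshot" where
  "look W c j = Snapshot
     (map_option (orient W j) (port (c j)))
     (image_mset (\<lambda>i. (ident W i, map_option (orient W j) (port (c i))))
        (mset_set {i. i < team W \<and> i \<noteq> j \<and> node (c i) = node (c j)}))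
     (landmark_at W = Some (node (c j)))"

definition decide :: "'m protocol \<Rightarrow> world \<Rightarrow> 'm config \<Rightarrow> nat \<Rightarrow> 'm \<times> dir option" where
  "decide A W c j = compute A (ident W j) (mem (c j)) (moved (c j)) (look W c j)"

definition wanted :: "'m protocol \<Rightarrow> world \<Rightarrow> 'm config \<Rightarrow> nat \<Rightarrow> side option" where
  "wanted A W c j = map_option (inv (orient W j)) (snd (decide A W c j))"

definition occupied :: "world \<Rightarrow> 'm config \<Rightarrow> nat \<Rightarrow> side \<Rightarrow> bool" where
  "occupied W c v s \<longleftrightarrow> (\<exists>i < team W. node (c i) = v \<and> port (c i) = Some s)"

definition requesters ::
    "'m protocol \<Rightarrow> world \<Rightarrow> 'm config \<Rightarrow> nat set \<Rightarrow> nat \<Rightarrow> side \<Rightarrow> nat set" where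
  "requesters A W c S v s =
     {j \<in> S. node (c j) = v \<and> wanted A W c j = Some s \<and> port (c j) \<noteq> Some s}"

text \<open>
  \<open>G\<close> is a possible set of agents that gain a port they were not already on, when \<open>S\<close> is the set of
  active agents. Occupancy is evaluated at the beginning of the round, so a port that is vacated
  during the round (by moving away or by changing ports) can only be gained in a later one.
\<close>

definition granted ::
    "'m protocol \<Rightarrow> world \<Rightarrow> 'm config \<Rightarrow> nat set \<Rightarrow> nat set \<Rightarrow> bool" where
  "granted A W c S G \<longleftrightarrow>
     G \<subseteq> (\<Union>v s. requesters A W c S v s) \<and>
     (\<forall>v s. if occupied W c v s then G \<inter> requesters A W c S v s = {}
            else requesters A W c S v s \<noteq> {} \<longrightarrow> (\<exists>!j. j \<in> G \<inter> requesters A W c S v s))"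

text \<open>
  The state of agent \<open>j\<close> after a round with active agents \<open>S\<close>, port winners \<open>G\<close> and missing edge \<open>e\<close>
  (\<open>None\<close> if all edges are present). An agent that computes nil or fails to gain its port stays
  exactly where it was, possibly on a port. An agent that traverses an edge arrives on no port.
\<close>

definition next_agent ::
    "'m protocol \<Rightarrow> world \<Rightarrow> 'm config \<Rightarrow> nat set \<Rightarrow> nat set \<Rightarrow> nat option \<Rightarrow> nat \<Rightarrow> 'm agent" where
  "next_agent A W c S G e j =
     (if j \<notin> S then c j
      else let a = (c j)\<lparr>mem := fst (decide A W c j)\<rparr> in
        case wanted A W c j of
          None \<Rightarrow> a
        | Some s \<Rightarrow>
            if port a = Some s \<or> j \<in> G then
              if e \<noteq> Some (port_edge (ring_size W) (node a) s)
              then a\<lparr>node := neighbour (ring_size W) (node a) s, port := None, moved := True\<rparr>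
              else a\<lparr>port := Some s, moved := False\<rparr>
            else a\<lparr>moved := False\<rparr>)"

text \<open>
  The initial value of \<open>moved\<close> is immaterial: it can be ignored by a protocol whose initial memory
  states are never re-entered.
\<close>

definition initial :: "'m protocol \<Rightarrow> world \<Rightarrow> 'm config \<Rightarrow> bool" where
  "initial A W c \<longleftrightarrow>
     (\<forall>j < team W. node (c j) < ring_size W \<and> port (c j) = None \<and>
        mem (c j) = init A (ident W j) \<and> \<not> moved (c j))"

definition ssync_schedule :: "world \<Rightarrow> (nat \<Rightarrow> nat set) \<Rightarrow> bool" where
  "ssync_schedule W act \<longleftrightarrow>
     (\<forall>t. act t \<noteq> {} \<and> act t \<subseteq> {..<team W}) \<and>
     (\<forall>j < team W. \<exists>\<^sub>\<infinity>t. j \<in> act t)"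

definition eventual_transport ::
    "world \<Rightarrow> (nat \<Rightarrow> nat set) \<Rightarrow> (nat \<Rightarrow> nat option) \<Rightarrow> (nat \<Rightarrow> 'm config) \<Rightarrow> bool" where
  "eventual_transport W act miss C \<longleftrightarrow>
     (\<forall>t. \<forall>j < team W. \<forall>s.
        let present = (\<lambda>u. miss u \<noteq> Some (port_edge (ring_size W) (node (C t j)) s)) in
        j \<notin> act t \<and> port (C t j) = Some s \<and> (\<exists>\<^sub>\<infinity>u. present u) \<longrightarrow>
        (\<exists>u > t. j \<in> act u \<and> present u))"

text \<open>
  \<open>C t\<close> is the configuration at the beginning of round \<open>t\<close>, \<open>act t\<close> the set of agents activated and
  \<open>miss t\<close> the edge missing in that round.
\<close>

definition execution ::
    "'m protocol \<Rightarrow> world \<Rightarrow> (nat \<Rightarrow> nat set) \<Rightarrow> (nat \<Rightarrow> nat option) \<Rightarrow> (nat \<Rightarrow> 'm config) \<Rightarrow> bool"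
  where
  "execution A W act miss C \<longleftrightarrow>
     initial A W (C 0) \<and> ssync_schedule W act \<and>
     (\<forall>t. \<forall>e. miss t = Some e \<longrightarrow> e < ring_size W) \<and>
     (\<forall>t. \<exists>G. granted A W (C t) (act t) G \<and>
        (\<forall>j < team W. C (Suc t) j = next_agent A W (C t) (act t) G (miss t) j)) \<and>
     eventual_transport W act miss C"

definition explored_by :: "world \<Rightarrow> (nat \<Rightarrow> 'm config) \<Rightarrow> nat \<Rightarrow> bool" where
  "explored_by W C t \<longleftrightarrow> (\<forall>v < ring_size W. \<exists>u \<le> t. \<exists>j < team W. node (C u j) = v)"

definition partially_terminating_exploration ::
    "'m protocol \<Rightarrow> world \<Rightarrow> (nat \<Rightarrow> 'm config) \<Rightarrow> bool" where
  "partially_terminating_exploration A W C \<longleftrightarrow>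
     (\<exists>t. explored_by W C t) \<and>
     (\<exists>t. \<exists>j < team W. terminal A (mem (C t j))) \<and>
     (\<forall>t. \<forall>j < team W. terminal A (mem (C t j)) \<longrightarrow> explored_by W C t)"

text \<open>
  The protocol may depend on \<open>N\<close>, \<open>k\<close>, the identifiers and the two flags, but not on the ring size,
  the landmark node, the orientations, the starting nodes or the adversary's choices.
\<close>

definition solves ::
    "nat \<Rightarrow> nat \<Rightarrow> (nat \<Rightarrow> nat) \<Rightarrow> bool \<Rightarrow> bool \<Rightarrow> 'm protocol \<Rightarrow> bool" where
  "solves N k ids has_landmark chirality A \<longleftrightarrow>
     wf_protocol A \<and>
     (\<forall>W act miss C.
        admissible N k ids has_landmark chirality W \<and> execution A W act miss C \<longrightarrow>
        partially_terminating_exploration A W C)"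

end

theory Submission
  imports Defs "HOL-Library.Infinite_Set"
begin

text \<open>
  On a ring of size \<open>n\<close> let edge \<open>n - 1\<close> be missing forever and activate the agents one at a time,
  in cyclic order. Eventual Transport holds, as every other edge is always present, so some agent
  terminates, say by round \<open>T\<close>. Now subdivide edge \<open>n - 1\<close> by a new node \<open>n\<close>. Until round \<open>T\<close> the
  adversary removes whichever half of the subdivided edge the single active agent might try to
  enter; the agents behave exactly as before, and one of them terminates although node \<open>n\<close> is
  unvisited. From round \<open>T\<close> on no edge is missing, so Eventual Transport holds here too.
\<close>

text \<open>With \<open>{i}\<close> as the active set nobody competes for a port, so the winners are
  forced: a request succeeds exactly if the port is free.\<close>

definition step :: "'m protocol \<Rightarrow> world \<Rightarrow> nat option \<Rightarrow> nat \<Rightarrow> 'm config \<Rightarrow> 'm config" where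
  "step A W e i c =
     next_agent A W c {i} {j. \<exists>v s. j \<in> requesters A W c {i} v s \<and> \<not> occupied W c v s} e"

definition start :: "'m protocol \<Rightarrow> world \<Rightarrow> 'm config" where
  "start A W = (\<lambda>j. \<lparr>node = 0, port = None, mem = init A (ident W j), moved = False\<rparr>)"

text \<open>The adversary \<open>f\<close> receives the current configuration because the edge it
  removes may depend on what the active agent is about to do.\<close>

primrec run ::
    "'m protocol \<Rightarrow> world \<Rightarrow> (nat \<Rightarrow> 'm config \<Rightarrow> nat option) \<Rightarrow> nat \<Rightarrow> 'm config" where
  "run A W f 0 = start A W"
| "run A W f (Suc t) = step A W (f t (run A W f t)) (t mod team W) (run A W f t)"

lemma granted_single:
  "granted A W c {i} {j. \<exists>v s. j \<in> requesters A W c {i} v s \<and> \<not> occupied W c v s}"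
  unfolding granted_def requesters_def by auto

lemma inf_mod_eq:
  assumes "j < k"
  shows "\<exists>\<^sub>\<infinity>t::nat. t mod k = j"
  unfolding INFM_nat
proof
  fix m
  have "j + k * Suc m > m" using assms by (cases k) auto
  moreover have "(j + k * Suc m) mod k = j"
    using assms by (simp del: mult_Suc_right)
  ultimately show "\<exists>t>m. t mod k = j" by blast
qed

text \<open>\<open>recurrent\<close> secures Eventual Transport: an edge present infinitely often is
  never missing from some round on, and cyclic activation wakes every agent again after that
  round.\<close>

lemma execution_run:
  assumes "0 < ring_size W" and "0 < team W"
    and edges: "\<And>t c e. f t c = Some e \<Longrightarrow> e < ring_size W"
    and recurrent: "\<And>e. \<exists>\<^sub>\<infinity>u. f u (run A W f u) \<noteq> Some e \<Longrightarrow>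
                          \<exists>T. \<forall>u\<ge>T. f u (run A W f u) \<noteq> Some e"
  shows "execution A W (\<lambda>t. {t mod team W}) (\<lambda>t. f t (run A W f t)) (run A W f)"
  unfolding execution_def
proof (intro conjI)
  show "initial A W (run A W f 0)"
    using assms(1) by (simp add: initial_def start_def)
  show "ssync_schedule W (\<lambda>t. {t mod team W})"
    using assms(2) inf_mod_eq by (auto simp: ssync_schedule_def eq_commute)
  show "\<forall>t e. f t (run A W f t) = Some e \<longrightarrow> e < ring_size W"
    using edges by blast
  show "\<forall>t. \<exists>G. granted A W (run A W f t) {t mod team W} G \<and>
      (\<forall>j<team W. run A W f (Suc t) j =
         next_agent A W (run A W f t) {t mod team W} G (f t (run A W f t)) j)"
    using granted_single by (fastforce simp: step_def)
  show "eventual_transport W (\<lambda>t. {t mod team W}) (\<lambda>t. f t (run A W f t)) (run A W f)"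
    unfolding eventual_transport_def Let_def
  proof (intro allI impI, elim conjE)
    fix t j s
    let ?e = "port_edge (ring_size W) (node (run A W f t j)) s"
    assume j: "j < team W" and "\<exists>\<^sub>\<infinity>u. f u (run A W f u) \<noteq> Some ?e"
    then obtain T where T: "\<forall>u\<ge>T. f u (run A W f u) \<noteq> Some ?e"
      using recurrent by blast
    obtain u where "u > max t T" "u mod team W = j"
      using inf_mod_eq[OF j] unfolding INFM_nat by blast
    then show "\<exists>u>t. j \<in> {u mod team W} \<and> f u (run A W f u) \<noteq> Some ?e"
      using T by (intro exI[of _ u]) auto
  qed
qed

lemma mod_pred:
  fixes v n :: nat
  assumes "v < n"
  shows "(v + n - 1) mod n = (if v = 0 then n - 1 else v - 1)"
proof (cases v)
  case (Suc w)
  then have "v + n - 1 = w + n" by simp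
  then show ?thesis using Suc assms by simp
qed (use assms in simp)

text \<open>After subdivision, edge \<open>n - 1\<close> joins nodes \<open>n - 1\<close> and
  \<open>n\<close>, and edge \<open>n\<close> joins nodes \<open>n\<close> and \<open>0\<close>. An
  old node meets the former only through \<open>Plus\<close> and the latter only through
  \<open>Minus\<close>, so the side alone tells which half to remove.\<close>

definition half_edge :: "nat \<Rightarrow> side \<Rightarrow> nat" where
  "half_edge n s = (case s of Plus \<Rightarrow> n - 1 | Minus \<Rightarrow> n)"

lemma half_edge_le: "half_edge n s \<le> n"
  by (cases s) (auto simp: half_edge_def)

lemma port_edge_subdivide:
  assumes "v < n"
  shows "half_edge n s = port_edge (Suc n) v s \<longleftrightarrow> n - 1 = port_edge n v s"
  using assms mod_pred[of v n] mod_pred[of v "Suc n"] by (cases s) (auto simp: half_edge_def)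

lemma neighbour_subdivide:
  assumes "v < n" and "n - 1 \<noteq> port_edge n v s"
  shows "neighbour (Suc n) v s = neighbour n v s"
  using assms mod_pred[of v n] mod_pred[of v "Suc n"] by (cases s) (auto split: if_splits)

lemma neighbour_less: "v < n \<Longrightarrow> neighbour n v s < n"
  by (cases s) auto

lemma wanted_ring_size [simp]: "wanted A (W\<lparr>ring_size := m\<rparr>) c j = wanted A W c j"
  by (simp add: wanted_def decide_def look_def)

lemma decide_ring_size [simp]: "decide A (W\<lparr>ring_size := m\<rparr>) c j = decide A W c j"
  by (simp add: decide_def look_def)

text \<open>A snapshot does not reveal the ring size, so the agent decides alike in both rings. It
  is blocked in one iff in the other; an unblocked move avoids the subdivided edge and ends at the
  same node.\<close>

lemma step_subdivide:
  assumes "\<And>j. node (c j) < ring_size W"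
  shows "step A (W\<lparr>ring_size := Suc (ring_size W)\<rparr>)
             (map_option (half_edge (ring_size W)) (wanted A W c i)) i c
         = step A W (Some (ring_size W - 1)) i c"
  using assms[of i] port_edge_subdivide[of "node (c i)" "ring_size W"]
    neighbour_subdivide[of "node (c i)" "ring_size W"]
  by (auto simp: fun_eq_iff step_def next_agent_def requesters_def occupied_def Let_def
      split: option.splits)

lemma node_step_less:
  assumes "\<And>j. node (c j) < ring_size W"
  shows "node (step A W e i c j) < ring_size W"
  using assms neighbour_less
  by (auto simp: step_def next_agent_def Let_def split: option.splits)

lemma node_run_less:
  assumes "0 < ring_size W"
  shows "node (run A W f t j) < ring_size W"
  using assms by (induction t arbitrary: j) (auto simp: start_def node_step_less)

definition delay :: "'m protocol \<Rightarrow> world \<Rightarrow> nat \<Rightarrow> nat \<Rightarrow> 'm config \<Rightarrow> nat option" where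
  "delay A W T t c =
     (if t < T then map_option (half_edge (ring_size W)) (wanted A W c (t mod team W)) else None)"

lemma run_subdivide:
  assumes "0 < ring_size W" and "t \<le> T"
  shows "run A (W\<lparr>ring_size := Suc (ring_size W)\<rparr>) (delay A W T) t
         = run A W (\<lambda>_ _. Some (ring_size W - 1)) t"
  using assms(2)
proof (induction t)
  case (Suc t)
  then show ?case
    by (simp add: delay_def step_subdivide node_run_less assms(1))
qed (simp add: start_def)

lemma not_solves_if_subdivision_admissible:
  assumes adm: "admissible N k ids has_landmark chirality W"
    and adm': "admissible N k ids has_landmark chirality (W\<lparr>ring_size := Suc (ring_size W)\<rparr>)"
    and k: "1 \<le> k"
  shows "\<not> solves N k ids has_landmark chirality A"
proof
  assume sol: "solves N k ids has_landmark chirality A"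
  let ?n = "ring_size W" and ?W = "W\<lparr>ring_size := Suc (ring_size W)\<rparr>"
  have n: "0 < ?n" and team: "0 < team W"
    using adm k by (auto simp: admissible_def)
  let ?C = "run A W (\<lambda>_ _. Some (?n - 1))"
  \<comment> \<open>Edge \<open>?n - 1\<close> is never present and every other edge is never
    missing, which gives \<open>recurrent\<close>.\<close>
  have "execution A W (\<lambda>t. {t mod team W}) (\<lambda>_. Some (?n - 1)) ?C"
    using execution_run[of W "\<lambda>_ _. Some (?n - 1)" A] n team by auto
  then obtain T j where j: "j < team W" "terminal A (mem (?C T j))"
    using sol adm unfolding solves_def partially_terminating_exploration_def by meson
  let ?D = "run A ?W (delay A W T)"
  have "execution A ?W (\<lambda>t. {t mod team ?W}) (\<lambda>t. delay A W T t (?D t)) ?D"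
  proof (rule execution_run)
    \<comment> \<open>Whatever was removed before round \<open>T\<close>, nothing is missing
      afterwards.\<close>
    show "\<exists>T'. \<forall>u\<ge>T'. delay A W T u (?D u) \<noteq> Some e" for e
      by (rule exI[of _ T]) (simp add: delay_def)
    show "e < ring_size ?W" if "delay A W T t c = Some e" for t c e
      using that by (auto simp: delay_def less_Suc_eq_le half_edge_le split: if_splits)
  qed (use team in auto)
  then have "partially_terminating_exploration A ?W ?D"
    using sol adm' unfolding solves_def by blast
  \<comment> \<open>\<open>?D T\<close> is the configuration before round \<open>T\<close>, so it
    depends only on rounds in which \<open>delay\<close> still blocks.\<close>
  moreover have "terminal A (mem (?D T j))"
    using j run_subdivide[OF n, of T T A] by simp
  ultimately have "explored_by ?W ?D T"
    using j unfolding partially_terminating_exploration_def by auto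
  then obtain u i where "u \<le> T" "node (?D u i) = ?n"
    unfolding explored_by_def by force
  moreover have "node (?D u i) < ?n" if "u \<le> T"
    using run_subdivide[OF n that, of A] node_run_less[OF n] by simp
  ultimately show False by simp
qed

theorem theorem19:
  fixes N k :: nat
    and ids :: "nat \<Rightarrow> nat"
    and has_landmark chirality :: bool
  assumes "4 \<le> N" and "1 \<le> k"
  shows "\<not> (\<exists>A :: 'm protocol. solves N k ids has_landmark chirality A)"
proof -
  \<comment> \<open>Size 3 is the least admissible one and its subdivision has size 4, whence
    \<open>4 \<le> N\<close>. A landmark at node \<open>0\<close> and a common orientation fit both
    sizes and all flags.\<close>
  let ?orient = "\<lambda>_ s. case s of Minus \<Rightarrow> Left | Plus \<Rightarrow> Right"
  let ?W = "\<lparr>ring_size = 3, landmark_at = (if has_landmark then Some 0 else None), team = k,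
    ident = ids, orient = ?orient\<rparr>"
  have "bij (case_side Left Right)"
    by (rule o_bij[of "case_dir Minus Plus"]) (auto simp: fun_eq_iff split: side.splits dir.splits)
  then have "admissible N k ids has_landmark chirality (?W\<lparr>ring_size := n\<rparr>)"
    if "3 \<le> n" "n \<le> 4" for n
    using that assms(1) by (auto simp: admissible_def intro: exI[of _ 0])
  from this[of 3] this[of 4] show ?thesis
    using not_solves_if_subdivision_admissible[of N k ids has_landmark chirality ?W] assms(2)
    by auto
qed

end
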